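(* Let $0<\alpha<1$, let $a<b$ be real numbers with $a\equiv b\pmod 1$, and let $f,g$ be real-valued functions defined on $\mathbb{N}_a\cap{}_{b}\mathbb{N}$. Then $$\sum_{s=a+1}^{b-1}g(s)\,({}^{C}\Delta_a^\alpha f)(s-\alpha)=f(s)\,\big({}_{b-1}\Delta^{-(1-\alpha)}g\big)(s-(1-\alpha))\Big|_{a}^{b-1}+\sum_{s=a}^{b-2}f(s)\,\big({}_{b-1}\Delta^\alpha g\big)(s+\alpha).$$
   Context: Notation: $\mathbb{N}_a=\{a,a+1,\dots\}$, ${}_{b}\mathbb{N}=\{b,b-1,\dots\}$; $\Delta f(t)=f(t+1)-f(t)$, $\nabla f(t)=f(t)-f(t-1)$; $\sigma(t)=t+1$; $F(s)\big|_{a}^{b-1}=F(b-1)-F(a)$; empty sums are $0$. Falling function: $t^{(\beta)}=\Gamma(t+1)/\Gamma(t+1-\beta)$ (division by a pole gives $0$). For $0<\alpha<1$: the delta left Caputo fractional difference is ${}^{C}\Delta_a^\alpha f(t)=\frac{1}{\Gamma(1-\alpha)}\sum_{s=a}^{t-(1-\alpha)}(t-\sigma(s))^{(-\alpha)}\Delta f(s)$, $t\in\mathbb{N}_{a+1-\alpha}$. For a real endpoint $d$, the delta right fractional sum of order $1-\alpha$ is ${}_{d}\Delta^{-(1-\alpha)}g(t)=\frac{1}{\Gamma(1-\alpha)}\sum_{s=t+(1-\alpha)}^{d}(s-\sigma(t))^{(-\alpha)}g(s)$, $t\in{}_{d-(1-\alpha)}\mathbb{N}$, and the delta right (Riemann)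 fractional difference is ${}_{d}\Delta^\alpha g(t)=-\nabla\big({}_{d}\Delta^{-(1-\alpha)}g\big)(t)$, evaluated where the right-hand side is defined. All summation indices run in unit steps. *)

theory Defs
  imports "HOL-Analysis.Gamma_Function" "HOL-Library.Real_Mod"
begin

definition nats_from :: "real \<Rightarrow> real set" where
  "nats_from a = {a + real k | k. True}"

definition nats_downto_from :: "real \<Rightarrow> real set" where
  "nats_downto_from b = {b - real k | k. True}"

text \<open>The summation range \<open>{l, l + 1, \<dots>, u}\<close> for real endpoints that agree modulo 1. It is empty
  when \<open>u < l\<close>, so sums over it then vanish.\<close>

definition unit_steps :: "real \<Rightarrow> real \<Rightarrow> real set" where
  "unit_steps l u = nats_from l \<inter> nats_downto_from u"

definition forward_diff :: "(real \<Rightarrow> real) \<Rightarrow> real \<Rightarrow> real" where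
  "forward_diff f t = f (t + 1) - f t"

definition backward_diff :: "(real \<Rightarrow> real) \<Rightarrow> real \<Rightarrow> real" where
  "backward_diff f t = f t - f (t - 1)"

definition jump :: "real \<Rightarrow> real" where
  "jump t = t + 1"

text \<open>The falling function \<open>t\<^sup>(\<^sup>\<beta>\<^sup>)\<close>. Since \<open>Gamma\<close> is 0 at its poles and \<open>x / 0 = 0\<close>,
  division by a pole gives 0.\<close>

definition falling :: "real \<Rightarrow> real \<Rightarrow> real" where
  "falling t \<beta> = Gamma (t + 1) / Gamma (t + 1 - \<beta>)"

text \<open>Functions on discrete sets are represented by total functions on the reals. The operators below
  are meant on the following domains: \<open>caputo_left_diff \<alpha> a f\<close> on \<open>nats_from (a + 1 - \<alpha>)\<close>, and
  \<open>right_frac_sum \<nu> d g\<close> on \<open>nats_downto_from (d - \<nu>)\<close>. On its domain each operator evaluates its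
  argument only at points of \<open>nats_from a\<close>, respectively \<open>nats_downto_from d\<close>.\<close>

definition caputo_left_diff :: "real \<Rightarrow> real \<Rightarrow> (real \<Rightarrow> real) \<Rightarrow> real \<Rightarrow> real" where
  "caputo_left_diff \<alpha> a f t =
     1 / Gamma (1 - \<alpha>) *
     (\<Sum>s\<in>unit_steps a (t - (1 - \<alpha>)). falling (t - jump s) (- \<alpha>) * forward_diff f s)"

text \<open>The sum \<open>\<^sub>d\<Delta>\<^sup>-\<^sup>\<nu>\<close> of order \<open>\<nu>\<close>; for \<open>\<nu> = 1 - \<alpha>\<close> the exponent \<open>\<nu> - 1\<close> of the kernel is \<open>-\<alpha>\<close>.\<close>

definition right_frac_sum :: "real \<Rightarrow> real \<Rightarrow> (real \<Rightarrow> real) \<Rightarrow> real \<Rightarrow> real" where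
  "right_frac_sum \<nu> d g t =
     1 / Gamma \<nu> *
     (\<Sum>s\<in>unit_steps (t + \<nu>) d. falling (s - jump t) (\<nu> - 1) * g s)"

definition right_frac_diff :: "real \<Rightarrow> real \<Rightarrow> (real \<Rightarrow> real) \<Rightarrow> real \<Rightarrow> real" where
  "right_frac_diff \<alpha> d g t = - backward_diff (right_frac_sum (1 - \<alpha>) d g) t"

definition eval_between :: "(real \<Rightarrow> real) \<Rightarrow> real \<Rightarrow> real \<Rightarrow> real" where
  "eval_between F l u = F u - F l"

end

theory Submission
  imports Defs
begin

text \<open>
  The identity is a summation by parts in which the fractional operators have been moved onto the
  other factor. Both operators are convolutions with the same kernel: on the lattice \<open>a + \<nat>\<close>, the
  shifts by \<open>\<alpha>\<close> and \<open>1 - \<alpha>\<close> in the statement cancel the shifts of the domains, and the weight that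
  joins the point \<open>a + k\<close> to an earlier point \<open>a + j\<close> depends on \<open>k - j\<close> alone. Hence the left
  Caputo difference of \<open>f\<close> is a lower triangular matrix applied to the increments of \<open>f\<close>, and the
  right fractional sum of \<open>g\<close> is the transposed matrix applied to \<open>g\<close>. Exchanging the two
  summations (lemma \<open>triangular_convolution_adjoint\<close>) turns the left-hand side into the sum of
  \<open>\<Delta>f(a + j) R(j + 1)\<close>, where \<open>R(j)\<close> is the right fractional sum of \<open>g\<close> read at the lattice index
  \<open>j\<close>. Abel's formula (lemma \<open>summation_by_parts\<close>) moves the difference from \<open>f\<close> to \<open>R\<close>; it leaves
  the boundary term, and \<open>-\<Delta>R\<close> is the right fractional difference.
\<close>

text \<open>The upper index is exclusive so that the empty range \<open>q = 0\<close> is covered as well; the last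
  sum of the theorem has this range when \<open>b = a + 1\<close>.\<close>

lemma unit_steps_eq_image:
  "unit_steps (x + real p) (x + real q - 1) = (\<lambda>k. x + real k) ` {p..<q}"
proof (intro equalityI subsetI)
  fix s assume "s \<in> unit_steps (x + real p) (x + real q - 1)"
  then obtain i j where i: "s = x + real p + real i" and j: "s = x + real q - 1 - real j"
    unfolding unit_steps_def nats_from_def nats_downto_from_def by blast
  from i j have "real (p + i + j + 1) = real q" by simp
  then have "p + i + j + 1 = q" by (simp only: of_nat_eq_iff)
  with i show "s \<in> (\<lambda>k. x + real k) ` {p..<q}"
    by (intro image_eqI[of _ _ "p + i"]) auto
next
  fix s assume "s \<in> (\<lambda>k. x + real k) ` {p..<q}"
  then obtain k where k: "s = x + real k" "p \<le> k" "k < q" by auto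
  then have "s = x + real p + real (k - p)" "s = x + real q - 1 - real (q - 1 - k)"
    by (auto simp: of_nat_diff)
  then show "s \<in> unit_steps (x + real p) (x + real q - 1)"
    unfolding unit_steps_def nats_from_def nats_downto_from_def by blast
qed

lemma sum_unit_steps:
  "l = x + real p \<Longrightarrow> u = x + real q - 1 \<Longrightarrow>
    (\<Sum>s\<in>unit_steps l u. h s) = (\<Sum>k=p..<q. h (x + real k))"
  by (simp add: unit_steps_eq_image sum.reindex inj_on_def)

lemma summation_by_parts:
  fixes u v :: "nat \<Rightarrow> 'a :: comm_ring"
  shows "(\<Sum>j<N. (u (Suc j) - u j) * v (Suc j)) =
    u N * v N - u 0 * v 0 - (\<Sum>j<N. u j * (v (Suc j) - v j))"
  by (induction N) (simp_all add: algebra_simps)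

text \<open>Both sides add the same terms over the pairs \<open>j < k \<le> N\<close>. On the right the lag \<open>k - Suc j\<close>
  makes the inner sum a convolution that starts at \<open>Suc j\<close>, so it is the fractional sum read one
  step later than the increment \<open>x j\<close>; Abel's formula needs exactly this offset.\<close>

lemma triangular_convolution_adjoint:
  fixes w x y :: "nat \<Rightarrow> 'a :: comm_semiring_0"
  shows "(\<Sum>k=1..<Suc N. y k * (\<Sum>j<k. w (k - Suc j) * x j)) =
    (\<Sum>j<N. x j * (\<Sum>k=Suc j..<Suc N. w (k - Suc j) * y k))"
proof -
  have "(\<Sum>k=1..<Suc N. y k * (\<Sum>j<k. w (k - Suc j) * x j)) =
      (\<Sum>k=1..<Suc N. \<Sum>j | j \<in> {..<N} \<and> j < k. y k * (w (k - Suc j) * x j))"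
    unfolding sum_distrib_left by (intro sum.cong) auto
  also have "\<dots> = (\<Sum>j<N. \<Sum>k | k \<in> {1..<Suc N} \<and> j < k. y k * (w (k - Suc j) * x j))"
    by (rule sum.swap_restrict) auto
  also have "\<dots> = (\<Sum>j<N. x j * (\<Sum>k=Suc j..<Suc N. w (k - Suc j) * y k))"
    unfolding sum_distrib_left by (intro sum.cong) (auto simp: mult_ac)
  finally show ?thesis .
qed

text \<open>The next two lemmas show the common kernel: in both operators, lag \<open>i\<close> has the weight
  \<open>falling (i - \<alpha>) (- \<alpha>)\<close>. For the Caputo difference the lag is counted from \<open>Suc j\<close>, the right end of
  the unit step on which the increment is taken.\<close>

lemma caputo_left_diff_at_lattice:
  "caputo_left_diff \<alpha> a f (a + real k - \<alpha>) =
    1 / Gamma (1 - \<alpha>) *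
      (\<Sum>j<k. falling (real (k - Suc j) - \<alpha>) (- \<alpha>) * (f (a + real (Suc j)) - f (a + real j)))"
proof -
  have "(\<Sum>s\<in>unit_steps a (a + real k - \<alpha> - (1 - \<alpha>)).
      falling (a + real k - \<alpha> - jump s) (- \<alpha>) * forward_diff f s) =
    (\<Sum>j=0..<k. falling (a + real k - \<alpha> - jump (a + real j)) (- \<alpha>) * forward_diff f (a + real j))"
    by (rule sum_unit_steps) auto
  also have "\<dots> = (\<Sum>j<k. falling (real (k - Suc j) - \<alpha>) (- \<alpha>) *
      (f (a + real (Suc j)) - f (a + real j)))"
    by (intro sum.cong) (auto simp: jump_def forward_diff_def of_nat_diff algebra_simps)
  finally show ?thesis by (simp add: caputo_left_diff_def)
qed

lemma right_frac_sum_at_lattice: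
  "right_frac_sum (1 - \<alpha>) (a + real N) g (a + real j - (1 - \<alpha>)) =
    1 / Gamma (1 - \<alpha>) *
      (\<Sum>k=j..<Suc N. falling (real (k - j) - \<alpha>) (- \<alpha>) * g (a + real k))"
proof -
  let ?t = "a + real j - (1 - \<alpha>)"
  have "(\<Sum>s\<in>unit_steps (?t + (1 - \<alpha>)) (a + real N).
      falling (s - jump ?t) (1 - \<alpha> - 1) * g s) =
    (\<Sum>k=j..<Suc N. falling (a + real k - jump ?t) (1 - \<alpha> - 1) * g (a + real k))"
    by (rule sum_unit_steps) auto
  also have "\<dots> = (\<Sum>k=j..<Suc N. falling (real (k - j) - \<alpha>) (- \<alpha>) * g (a + real k))"
    by (intro sum.cong) (auto simp: jump_def of_nat_diff algebra_simps)
  finally show ?thesis by (simp add: right_frac_sum_def)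
qed

theorem theorem6p8:
  fixes \<alpha> a b :: real and f g :: "real \<Rightarrow> real"
  assumes "0 < \<alpha>" and "\<alpha> < 1"
    and "a < b" and "[a = b] (rmod 1)"
  shows "(\<Sum>s\<in>unit_steps (a + 1) (b - 1). g s * caputo_left_diff \<alpha> a f (s - \<alpha>)) =
         eval_between (\<lambda>s. f s * right_frac_sum (1 - \<alpha>) (b - 1) g (s - (1 - \<alpha>))) a (b - 1) +
         (\<Sum>s\<in>unit_steps a (b - 2). f s * right_frac_diff \<alpha> (b - 1) g (s + \<alpha>))"
proof -
  obtain m :: int where m: "b = a + of_int m"
    using assms(4) by (auto simp: rcong_altdef)
  with assms(3) have "m > 0" by simp
  define N where "N = nat (m - 1)"
  have b: "b = a + real N + 1"
    using m \<open>m > 0\<close> by (simp add: N_def)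
  define c where "c = 1 / Gamma (1 - \<alpha>)"
  define w where "w i = falling (real i - \<alpha>) (- \<alpha>)" for i :: nat
  define u where "u j = f (a + real j)" for j
  define y where "y k = g (a + real k)" for k
  define R where "R j = right_frac_sum (1 - \<alpha>) (b - 1) g (a + real j - (1 - \<alpha>))" for j
  have R: "R j = c * (\<Sum>k=j..<Suc N. w (k - j) * y k)" for j
    using right_frac_sum_at_lattice[of \<alpha> a N g j] by (simp add: R_def b c_def w_def y_def)

  have "(\<Sum>s\<in>unit_steps (a + 1) (b - 1). g s * caputo_left_diff \<alpha> a f (s - \<alpha>)) =
      (\<Sum>k=1..<Suc N. y k * caputo_left_diff \<alpha> a f (a + real k - \<alpha>))"
    unfolding y_def by (rule sum_unit_steps) (auto simp: b)
  also have "\<dots> = (\<Sum>k=1..<Suc N. c * (y k * (\<Sum>j<k. w (k - Suc j) * (u (Suc j) - u j))))"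
    by (simp only: caputo_left_diff_at_lattice c_def w_def u_def mult.left_commute)
  also have "\<dots> = c * (\<Sum>j<N. (u (Suc j) - u j) * (\<Sum>k=Suc j..<Suc N. w (k - Suc j) * y k))"
    unfolding sum_distrib_left[of c, symmetric]
    by (simp only: triangular_convolution_adjoint[of y w "\<lambda>j. u (Suc j) - u j"])
  also have "\<dots> = (\<Sum>j<N. (u (Suc j) - u j) * R (Suc j))"
    by (subst sum_distrib_left) (simp only: R mult.left_commute)
  also have "\<dots> = u N * R N - u 0 * R 0 + (\<Sum>j<N. u j * - (R (Suc j) - R j))"
    by (simp add: summation_by_parts sum_negf del: minus_diff_eq)
  also have "u N * R N - u 0 * R 0 =
      eval_between (\<lambda>s. f s * right_frac_sum (1 - \<alpha>) (b - 1) g (s - (1 - \<alpha>))) a (b - 1)"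
    by (simp add: eval_between_def u_def R_def b)
  also have "(\<Sum>j<N. u j * - (R (Suc j) - R j)) =
      (\<Sum>j=0..<N. f (a + real j) * right_frac_diff \<alpha> (b - 1) g (a + real j + \<alpha>))"
  proof (intro sum.cong)
    fix j
    \<comment> \<open>The argument \<open>a + j + \<alpha>\<close> of the right difference is the point \<open>a + (j + 1) - (1 - \<alpha>)\<close> at
        which \<open>R (Suc j)\<close> is read: this is why the backward difference becomes a forward one.\<close>
    have "a + real j + \<alpha> = a + real (Suc j) - (1 - \<alpha>)"
      and "a + real j + \<alpha> - 1 = a + real j - (1 - \<alpha>)" by simp_all
    then show "u j * - (R (Suc j) - R j) =
        f (a + real j) * right_frac_diff \<alpha> (b - 1) g (a + real j + \<alpha>)"
      unfolding right_frac_diff_def backward_diff_def u_def R_def by (simp only:)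
  qed auto
  also have "\<dots> = (\<Sum>s\<in>unit_steps a (b - 2). f s * right_frac_diff \<alpha> (b - 1) g (s + \<alpha>))"
    by (rule sum_unit_steps[symmetric]) (auto simp: b)
  finally show ?thesis .
qed

end
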